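(* Let $f:\mathbb{R}^n\to\mathbb{R}$ be a polynomial with Hermite expansion $f=\sum_\alpha\hat f(\alpha)h_\alpha$, let $\lambda\in(0,1)$, and let $g:=U_{\sqrt{1-\lambda}}f$. Then for every multi-index $\alpha$ and all $x,y\in\mathbb{R}^n$, $$(\partial^\alpha f)\big(\sqrt{1-\lambda}\,x+\sqrt\lambda\,y\big)=(1-\lambda)^{-|\alpha|/2}\sum_{\beta\geq\alpha}\frac{\partial^\beta g(x)}{\sqrt{(\beta-\alpha)!}}\left(\frac{\lambda}{1-\lambda}\right)^{|\beta-\alpha|/2}h_{\beta-\alpha}(y).$$
   Context: $He_m$ are the probabilists' Hermite polynomials ($e^{st-s^2/2}=\sum_mHe_m(t)s^m/m!$), $h_m:=He_m/\sqrt{m!}$, $h_\alpha(x)=\prod_ih_{\alpha_i}(x_i)$ for $\alpha\in\mathbb{N}^n$; $\hat f(\alpha)$ are the coefficients of $f$ in this basis. For $\rho\geq0$, $U_\rho$ is the linear operator with $U_\rho h_\alpha=\rho^{|\alpha|}h_\alpha$. Multi-index conventions: $\alpha!=\prod_i\alpha_i!$, $|\alpha|=\sum_i\alpha_i$, $\beta\geq\alpha$ componentwise. The left side means $\partial^\alpha f$ evaluated at the indicated point. *)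

theory Defs
  imports "HOL-Analysis.Analysis" "HOL-Computational_Algebra.Formal_Power_Series"
begin

text \<open>The generating function \<open>exp (s t - s\<^sup>2 / 2) = (\<Sum>m. He m t * s ^ m / m!)\<close>, read as a formal power
  series in \<open>s\<close>.\<close>

definition He :: "nat \<Rightarrow> real \<Rightarrow> real" where
  "He m t = fact m *
     fps_nth (fps_exp 1 oo (fps_const t * fps_X - fps_const (1/2) * fps_X ^ 2)) m"

definition hermite1 :: "nat \<Rightarrow> real \<Rightarrow> real" where
  "hermite1 m t = He m t / sqrt (fact m)"

text \<open>Multi-indices are functions \<open>'n \<Rightarrow> nat\<close>; their order and their subtraction are the library's
  pointwise ones.\<close>

definition mabs :: "('n::finite \<Rightarrow> nat) \<Rightarrow> nat" where
  "mabs \<alpha> = (\<Sum>i\<in>UNIV. \<alpha> i)"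

definition mfact :: "('n::finite \<Rightarrow> nat) \<Rightarrow> real" where
  "mfact \<alpha> = (\<Prod>i\<in>UNIV. fact (\<alpha> i))"

definition hermite :: "('n::finite \<Rightarrow> nat) \<Rightarrow> real ^ 'n \<Rightarrow> real" where
  "hermite \<alpha> x = (\<Prod>i\<in>UNIV. hermite1 (\<alpha> i) (vec_nth x i))"

text \<open>The coordinates of \<open>f\<close> in the basis \<open>hermite\<close> of the space of polynomial functions; meaningful
  only for polynomial \<open>f\<close>.\<close>

definition hermite_coeff :: "(real ^ 'n::finite \<Rightarrow> real) \<Rightarrow> ('n \<Rightarrow> nat) \<Rightarrow> real" where
  "hermite_coeff f = (THE c. finite {\<alpha>. c \<alpha> \<noteq> 0} \<and>
     (\<forall>x. f x = (\<Sum>\<alpha> | c \<alpha> \<noteq> 0. c \<alpha> * hermite \<alpha> x)))"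

text \<open>The linear operator on polynomial functions that maps each \<open>hermite \<alpha>\<close> to
  \<open>\<rho> ^ mabs \<alpha>\<close> times itself.\<close>

definition noise_op :: "real \<Rightarrow> (real ^ 'n::finite \<Rightarrow> real) \<Rightarrow> real ^ 'n \<Rightarrow> real" where
  "noise_op \<rho> f x = (\<Sum>\<alpha> | hermite_coeff f \<alpha> \<noteq> 0.
     hermite_coeff f \<alpha> * (\<rho> ^ mabs \<alpha> * hermite \<alpha> x))"

definition partial_deriv :: "'n::finite \<Rightarrow> (real ^ 'n \<Rightarrow> real) \<Rightarrow> real ^ 'n \<Rightarrow> real" where
  "partial_deriv i f x = deriv (\<lambda>t. f (x + t *\<^sub>R axis i 1)) 0"

text \<open>The index type carries no order, so a mixed derivative is taken along an arbitrary fixed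
  enumeration of the coordinates. For smooth functions, in particular polynomials, partial
  derivatives commute and the choice is immaterial.\<close>

definition coords :: "'n::finite list" where
  "coords = (SOME xs. distinct xs \<and> set xs = UNIV)"

definition mixed_deriv :: "('n::finite \<Rightarrow> nat) \<Rightarrow> (real ^ 'n \<Rightarrow> real) \<Rightarrow> real ^ 'n \<Rightarrow> real" where
  "mixed_deriv \<alpha> f = foldr (\<lambda>i. partial_deriv i ^^ \<alpha> i) coords f"

end

theory Submission
  imports Defs
begin

text \<open>The generating function \<open>F\<close> of the Hermite polynomials at \<open>t\<close> is determined by \<open>F' = (t - X) F\<close> and
  \<open>F(0) = 1\<close>. For \<open>a\<^sup>2 + b\<^sup>2 = 1\<close> the product of the generating functions at \<open>s\<close> and \<open>t\<close>, rescaled by \<open>a\<close>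
  and \<open>b\<close>, solves the same equation at \<open>a s + b t\<close>; comparing coefficients expands \<open>He\<^sub>m(a s + b t)\<close> in
  products \<open>He\<^sub>m\<^sub>-\<^sub>k(s) He\<^sub>k(t)\<close>. As \<open>He\<^sub>m' = m He\<^sub>m\<^sub>-\<^sub>1\<close>, this is the claimed identity for \<open>f = He\<^sub>m\<close> with \<open>a\<^sup>2 = 1 - \<lambda>\<close>,
  \<open>b\<^sup>2 = \<lambda>\<close>. Multiplying over the coordinates gives it for Hermite products, and linearity for all
  polynomials.\<close>

section \<open>Hermite polynomials in one variable\<close>

text \<open>The coefficient of index m in the equation expresses (m + 1) F_(m+1) through F_0, ...,
  F_m, and m + 1 is invertible in characteristic 0. So F_0 and \<open>p\<close> determine the series
  by strong induction.\<close>

lemma fps_linear_ode_unique: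
  fixes F G p :: "'a::field_char_0 fps"
  assumes F: "fps_deriv F = p * F" and G: "fps_deriv G = p * G"
    and 0: "fps_nth F 0 = fps_nth G 0"
  shows "F = G"
proof (rule fps_ext)
  fix n
  show "fps_nth F n = fps_nth G n"
  proof (induction n rule: less_induct)
    case (less n)
    show ?case
    proof (cases n)
      case (Suc m)
      have "of_nat (Suc m) * fps_nth F (Suc m) = (\<Sum>i=0..m. fps_nth p i * fps_nth F (m - i))"
        using arg_cong[OF F, of "\<lambda>H. fps_nth H m"] by (simp add: fps_mult_nth)
      also have "\<dots> = (\<Sum>i=0..m. fps_nth p i * fps_nth G (m - i))"
        using less Suc by (intro sum.cong) auto
      also have "\<dots> = of_nat (Suc m) * fps_nth G (Suc m)"
        using arg_cong[OF G, of "\<lambda>H. fps_nth H m"] by (simp add: fps_mult_nth)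
      finally show ?thesis
        using Suc by (simp only: mult_cancel_left of_nat_eq_0_iff) simp
    qed (use 0 in simp)
  qed
qed

definition He_gf :: "real \<Rightarrow> real fps" where
  "He_gf t = fps_exp 1 oo (fps_const t * fps_X - fps_const (1/2) * fps_X ^ 2)"

lemma He_gf_nth: "fps_nth (He_gf t) m = He m t / fact m"
  by (simp add: He_gf_def He_def)

lemma He_gf_nth_0 [simp]: "fps_nth (He_gf t) 0 = 1"
  by (simp add: He_gf_def)

lemma He_gf_deriv: "fps_deriv (He_gf t) = (fps_const t - fps_X) * He_gf t"
proof -
  have "fps_deriv (fps_const t * fps_X - fps_const (1/2) * fps_X ^ 2) = fps_const t - fps_X"
    by (rule fps_ext) (simp add: power2_eq_square numeral_fps_const)
  then show ?thesis
    unfolding He_gf_def by (subst fps_compose_deriv) (simp_all add: mult.commute)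
qed

lemma He_0 [simp]: "He 0 t = 1"
  using He_gf_nth[of t 0] by simp

lemma He_1 [simp]: "He (Suc 0) t = t"
  using arg_cong[OF He_gf_deriv[of t], of "\<lambda>F. fps_nth F 0"] by (simp add: He_gf_nth)

text \<open>This is the coefficient of index m + 1 in \<open>He_gf_deriv\<close>; the rest of the
  proof clears factorials.\<close>

lemma He_Suc_Suc: "He (Suc (Suc m)) t = t * He (Suc m) t - real (Suc m) * He m t"
proof -
  have "real (Suc (Suc m)) * (He (Suc (Suc m)) t / fact (Suc (Suc m))) =
      t * (He (Suc m) t / fact (Suc m)) - He m t / fact m"
    using arg_cong[OF He_gf_deriv[of t], of "\<lambda>F. fps_nth F (Suc m)"]
    by (simp add: He_gf_nth left_diff_distrib del: fact_Suc of_nat_Suc)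
  then have "He (Suc (Suc m)) t / fact (Suc m) = t * He (Suc m) t / fact (Suc m) - He m t / fact m"
    by (simp add: fact_Suc[of "Suc m"] del: fact_Suc of_nat_Suc)
  also have "He m t / fact m = real (Suc m) * He m t / fact (Suc m)"
    by (simp del: of_nat_Suc)
  finally show ?thesis
    by (simp add: divide_simps del: fact_Suc of_nat_Suc)
qed

text \<open>The recurrence without a separate start: for \<open>m = 0\<close> the truncated index
  \<open>m - 1\<close> is harmless, as its factor is 0.\<close>

lemma He_Suc: "He (Suc m) t = t * He m t - real m * He (m - 1) t"
  by (cases m) (simp_all add: He_Suc_Suc)

text \<open>Differentiating the recurrence and inserting the hypotheses for k + 1 and k gives
  He_(k+1) + (k + 1) (t He_k - k He_(k-1)), and the bracket is again He_(k+1).\<close>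

lemma He_has_field_derivative:
  "(He m has_field_derivative real m * He (m - 1) t) (at t)"
proof (induction m rule: less_induct)
  case (less m)
  consider "m = 0" | "m = 1" | k where "m = Suc (Suc k)"
    by (metis One_nat_def not0_implies_Suc)
  then show ?case
  proof cases
    case 1
    then have "He m = (\<lambda>_. 1)" by auto
    then show ?thesis using 1 by simp
  next
    case 2
    then have "He m = (\<lambda>t. t)" by auto
    then show ?thesis using 2 by simp
  next
    case (3 k)
    have "((\<lambda>t. t * He (Suc k) t - real (Suc k) * He k t) has_field_derivative
        1 * He (Suc k) t + real (Suc k) * He (Suc k - 1) t * t - real (Suc k) * (real k * He (k - 1) t)) (at t)"
      by (intro DERIV_diff DERIV_mult DERIV_cmult DERIV_ident less) (simp_all add: 3)
    moreover have "He m = (\<lambda>t. t * He (Suc k) t - real (Suc k) * He k t)"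
      using 3 He_Suc_Suc by auto
    moreover have "1 * He (Suc k) t + real (Suc k) * He (Suc k - 1) t * t - real (Suc k) * (real k * He (k - 1) t)
        = real m * He (m - 1) t"
      by (simp add: 3 He_Suc algebra_simps)
    ultimately show ?thesis by simp
  qed
qed

lemma He_rotation:
  assumes ab: "a\<^sup>2 + b\<^sup>2 = 1"
  shows "He m (a * s + b * t) =
    (\<Sum>k\<le>m. real (m choose k) * a ^ (m - k) * b ^ k * He (m - k) s * He k t)"
proof -
  \<comment> \<open>Substituting \<open>c * X\<close> for the series variable multiplies the
    coefficient of index n by \<open>c ^ n\<close>.\<close>
  define S where "S c t = He_gf t oo (fps_const c * fps_X)" for c t
  have S_deriv: "fps_deriv (S c t) = fps_const c * (fps_const t - fps_const c * fps_X) * S c t" for c t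
    unfolding S_def
    by (subst fps_compose_deriv) (simp_all add: He_gf_deriv fps_compose_mult_distrib fps_compose_sub_distrib mult.commute)
  have S_nth: "fps_nth (S c t) n = c ^ n * He n t / fact n" for c t n
    unfolding S_def by (simp add: fps_compose_linear He_gf_nth)
  have const: "fps_const (a * s + b * t) = fps_const a * fps_const s + fps_const b * fps_const t"
    "fps_const (a\<^sup>2 + b\<^sup>2) = fps_const a * fps_const a + fps_const b * fps_const b"
    by (simp_all add: power2_eq_square)
  \<comment> \<open>The logarithmic derivatives a (s - a X) and b (t - b X) add up. With
    \<open>S b t\<close> as the first factor, the Cauchy product attaches k to \<open>t\<close> and
    m - k to \<open>s\<close>.\<close>
  have "fps_deriv (S b t * S a s) = (fps_const (a * s + b * t) - fps_const (a\<^sup>2 + b\<^sup>2) * fps_X) * (S b t * S a s)"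
    unfolding const fps_deriv_mult S_deriv by (simp only: algebra_simps)
  then have "S b t * S a s = He_gf (a * s + b * t)"
    using ab by (intro fps_linear_ode_unique[OF _ He_gf_deriv]) (simp_all add: S_nth)
  then have "He m (a * s + b * t) = fact m * fps_nth (S b t * S a s) m"
    by (simp add: He_gf_nth)
  also have "\<dots> = (\<Sum>k\<le>m. real (m choose k) * a ^ (m - k) * b ^ k * He (m - k) s * He k t)"
    unfolding fps_mult_nth S_nth sum_distrib_left atMost_atLeast0
    by (intro sum.cong) (simp_all add: binomial_fact field_simps)
  finally show ?thesis .
qed


section \<open>Products of Hermite polynomials and their derivatives\<close>

text \<open>The unnormalised form of \<open>hermite\<close>: differentiation and multiplication by a
  coordinate then involve no square roots.\<close>

definition multi_He :: "('n::finite \<Rightarrow> nat) \<Rightarrow> real ^ 'n \<Rightarrow> real" where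
  "multi_He \<alpha> x = (\<Prod>i\<in>UNIV. He (\<alpha> i) (x $ i))"

lemma mfact_pos: "mfact \<alpha> > 0"
  by (simp add: mfact_def prod_pos)

lemma sqrt_prod: "sqrt (\<Prod>i\<in>A. f i) = (\<Prod>i\<in>A. sqrt (f i))"
  by (induction A rule: infinite_finite_induct) (simp_all add: real_sqrt_mult)

lemma hermite_eq_multi_He: "hermite \<alpha> x = multi_He \<alpha> x / sqrt (mfact \<alpha>)"
  by (simp add: hermite_def hermite1_def multi_He_def mfact_def sqrt_prod prod_dividef)

lemma multi_He_0 [simp]: "multi_He (\<lambda>_. 0) x = 1"
  by (simp add: multi_He_def)

lemma multi_He_remove: "multi_He \<alpha> x = He (\<alpha> i) (x $ i) * (\<Prod>j\<in>UNIV - {i}. He (\<alpha> j) (x $ j))"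
  unfolding multi_He_def by (rule prod.remove) auto

lemma multi_He_upd:
  "multi_He (\<alpha>(i := k)) x = He k (x $ i) * (\<Prod>j\<in>UNIV - {i}. He (\<alpha> j) (x $ j))"
  unfolding multi_He_remove[of "\<alpha>(i := k)" x i] by (auto intro!: prod.cong)

lemma multi_He_times_coord:
  "x $ i * multi_He \<alpha> x = multi_He (\<alpha>(i := Suc (\<alpha> i))) x + real (\<alpha> i) * multi_He (\<alpha>(i := \<alpha> i - 1)) x"
  unfolding multi_He_upd multi_He_remove[of \<alpha> x i] by (simp add: He_Suc algebra_simps)

lemma multi_He_has_field_derivative:
  "((\<lambda>t. multi_He \<alpha> (x + t *\<^sub>R axis i 1)) has_field_derivative
     real (\<alpha> i) * multi_He (\<alpha>(i := \<alpha> i - 1)) x) (at 0)"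
proof -
  have *: "multi_He \<alpha> (x + t *\<^sub>R axis i 1) =
      He (\<alpha> i) (x $ i + t) * (\<Prod>j\<in>UNIV - {i}. He (\<alpha> j) (x $ j))" for t
    unfolding multi_He_remove[of \<alpha> _ i]
    by (auto intro!: prod.cong arg_cong2[of _ _ _ _ "(*)"] simp: axis_def)
  have "((\<lambda>t. He (\<alpha> i) (x $ i + t)) has_field_derivative real (\<alpha> i) * He (\<alpha> i - 1) (x $ i)) (at 0)"
    using DERIV_shift[of "He (\<alpha> i)" _ 0 "x $ i"] He_has_field_derivative[of "\<alpha> i" "x $ i"]
    by (simp add: add.commute)
  from DERIV_cmult_right[OF this] show ?thesis
    unfolding * multi_He_upd by (simp add: mult.assoc)
qed

text \<open>The index map \<open>d\<close> is arbitrary because lowering with truncation can make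
  distinct multi-indices coincide. In this form the result is a sum of the same shape, ready for the
  next derivative.\<close>

lemma partial_deriv_sum_multi_He:
  assumes "finite A"
  shows "partial_deriv i (\<lambda>x. \<Sum>a\<in>A. c a * multi_He (d a) x) =
    (\<lambda>x. \<Sum>a\<in>A. (c a * real (d a i)) * multi_He ((d a)(i := d a i - 1)) x)"
  unfolding partial_deriv_def mult.assoc
  by (intro ext DERIV_imp_deriv DERIV_sum DERIV_cmult multi_He_has_field_derivative)

text \<open>The falling factorial m (m - 1) ... (m - k + 1), the factor produced by k derivatives of
  He_m. The binomial form makes it vanish for k > m.\<close>

definition falling_fact :: "nat \<Rightarrow> nat \<Rightarrow> real" where
  "falling_fact m k = fact k * real (m choose k)"

lemma falling_fact_0 [simp]: "falling_fact m 0 = 1"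
  by (simp add: falling_fact_def)

lemma falling_fact_self [simp]: "falling_fact m m = fact m"
  by (simp add: falling_fact_def)

lemma falling_fact_eq_0_iff: "falling_fact m k = 0 \<longleftrightarrow> m < k"
  by (auto simp: falling_fact_def binomial_eq_0_iff)

lemma falling_fact_fact: "k \<le> m \<Longrightarrow> falling_fact m k = fact m / fact (m - k)"
  by (simp add: falling_fact_def binomial_fact)

lemma falling_fact_Suc: "falling_fact m (Suc k) = falling_fact m k * real (m - k)"
proof (cases "Suc k \<le> m")
  case True
  then have "m - k = Suc (m - Suc k)" by simp
  then have "fact (m - k) = real (m - k) * fact (m - Suc k)"
    by (metis fact_Suc)
  then show ?thesis using True by (simp add: falling_fact_fact)
next
  case False
  then show ?thesis by (auto simp: falling_fact_def)
qed

lemma funpow_partial_deriv_sum_multi_He: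
  assumes "finite A"
  shows "(partial_deriv i ^^ k) (\<lambda>x. \<Sum>a\<in>A. c a * multi_He (d a) x) =
    (\<lambda>x. \<Sum>a\<in>A. (c a * falling_fact (d a i) k) * multi_He ((d a)(i := d a i - k)) x)"
proof (induction k)
  case (Suc k)
  show ?case
    unfolding funpow.simps comp_def Suc.IH partial_deriv_sum_multi_He[OF assms]
    unfolding fun_upd_upd fun_upd_same falling_fact_Suc mult.assoc
    by simp
qed simp

text \<open>Since \<open>xs\<close> is distinct, the derivatives along its tail leave the coordinate
  at its head unchanged, so each factor \<open>falling_fact\<close> sees the original entry
  \<open>d a i\<close>.\<close>

lemma foldr_partial_deriv_sum_multi_He:
  assumes "finite A" and "distinct xs"
  shows "foldr (\<lambda>i. partial_deriv i ^^ \<alpha> i) xs (\<lambda>x. \<Sum>a\<in>A. c a * multi_He (d a) x) =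
    (\<lambda>x. \<Sum>a\<in>A. (c a * (\<Prod>i\<in>set xs. falling_fact (d a i) (\<alpha> i))) *
       multi_He (\<lambda>i. if i \<in> set xs then d a i - \<alpha> i else d a i) x)"
  using assms(2)
proof (induction xs)
  case (Cons i xs)
  have "(\<lambda>j. if j \<in> set xs then d a j - \<alpha> j else d a j)
      (i := d a i - \<alpha> i) = (\<lambda>j. if j \<in> set (i # xs) then d a j - \<alpha> j else d a j)" for a
    using Cons.prems by auto
  then show ?case
    using Cons.prems
    unfolding foldr.simps comp_def Cons.IH[OF distinct_tl[OF Cons.prems, simplified]]
      funpow_partial_deriv_sum_multi_He[OF assms(1)]
    by (simp add: mult_ac)
qed simp

lemma coords_enum: "distinct (coords :: 'n::finite list)" "set (coords :: 'n list) = UNIV"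
proof -
  have "\<exists>xs :: 'n list. distinct xs \<and> set xs = UNIV"
    using finite_distinct_list[of "UNIV :: 'n set"] by auto
  from someI_ex[OF this] show "distinct (coords :: 'n list)" "set (coords :: 'n list) = UNIV"
    by (simp_all add: coords_def)
qed

lemma mixed_deriv_sum_multi_He:
  assumes "finite A"
  shows "mixed_deriv \<alpha> (\<lambda>x. \<Sum>a\<in>A. c a * multi_He (d a) x) =
    (\<lambda>x. \<Sum>a\<in>A. c a * (\<Prod>i\<in>UNIV. falling_fact (d a i) (\<alpha> i)) * multi_He (d a - \<alpha>) x)"
  unfolding mixed_deriv_def foldr_partial_deriv_sum_multi_He[OF assms coords_enum(1)]
  by (simp add: coords_enum(2) fun_diff_def)

text \<open>This removes exactly the terms in which \<open>\<gamma> - \<alpha>\<close>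
  truncates.\<close>

lemma prod_falling_fact_eq_0_iff:
  fixes \<alpha> \<gamma> :: "'n::finite \<Rightarrow> nat"
  shows "(\<Prod>i\<in>UNIV. falling_fact (\<gamma> i) (\<alpha> i)) = 0 \<longleftrightarrow> \<not> \<alpha> \<le> \<gamma>"
  by (auto simp: falling_fact_eq_0_iff le_fun_def not_le)

section \<open>The Hermite expansion of a polynomial\<close>

text \<open>The mixed derivative at a maximal index of the support isolates one coefficient.\<close>

lemma multi_He_sum_eq_0D:
  fixes A :: "('n::finite \<Rightarrow> nat) set"
  assumes A: "finite A" and eq: "\<And>x. (\<Sum>\<gamma>\<in>A. c \<gamma> * multi_He \<gamma> x) = 0" and "\<gamma> \<in> A"
  shows "c \<gamma> = 0"
proof (rule ccontr)
  assume "c \<gamma> \<noteq> 0"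
  define B where "B = {\<gamma> \<in> A. c \<gamma> \<noteq> 0}"
  have B: "finite B" "\<gamma> \<in> B"
    using A \<open>\<gamma> \<in> A\<close> \<open>c \<gamma> \<noteq> 0\<close> by (auto simp: B_def)
  obtain \<alpha> where \<alpha>: "\<alpha> \<in> B" "\<And>\<beta>. \<beta> \<in> B \<Longrightarrow> \<alpha> \<le> \<beta> \<Longrightarrow> \<alpha> = \<beta>"
    using finite_has_maximal[OF B(1)] B(2) by blast
  have "(\<Sum>\<gamma>\<in>A. c \<gamma> * (\<Prod>i\<in>UNIV. falling_fact (\<gamma> i) (\<alpha> i)) * multi_He (\<gamma> - \<alpha>) 0) =
      mixed_deriv \<alpha> (\<lambda>x. \<Sum>\<gamma>\<in>A. c \<gamma> * multi_He \<gamma> x) 0"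
    by (simp add: mixed_deriv_sum_multi_He[OF A, where d = "\<lambda>\<gamma>. \<gamma>"])
  \<comment> \<open>The zero function is written as an empty sum so that the derivative formula
    applies to it.\<close>
  also have "\<dots> = mixed_deriv \<alpha> (\<lambda>x. \<Sum>\<gamma>\<in>({} :: ('n \<Rightarrow> nat) set). c \<gamma> * multi_He \<gamma> x) 0"
    by (simp add: eq)
  also have "\<dots> = 0"
    by (subst mixed_deriv_sum_multi_He) auto
  \<comment> \<open>By maximality of \<open>\<alpha>\<close>, any other index either has coefficient
    0 or is not above \<open>\<alpha>\<close>. The surviving term is c(alpha) alpha!.\<close>
  also have "(\<Sum>\<gamma>\<in>A. c \<gamma> * (\<Prod>i\<in>UNIV. falling_fact (\<gamma> i) (\<alpha> i)) * multi_He (\<gamma> - \<alpha>) 0) =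
      (\<Sum>\<gamma>\<in>{\<alpha>}. c \<gamma> * (\<Prod>i\<in>UNIV. falling_fact (\<gamma> i) (\<alpha> i)) * multi_He (\<gamma> - \<alpha>) 0)"
    using \<alpha> A by (intro sum.mono_neutral_right)
      (auto simp: B_def prod_falling_fact_eq_0_iff)
  finally show False
    using \<alpha>(1) by (simp add: B_def fun_diff_def)
qed

lemma finite_atMost_multi_index: "finite {\<beta> :: 'n::finite \<Rightarrow> nat. \<beta> \<le> \<gamma>}"
proof -
  have "{\<beta>. \<beta> \<le> \<gamma>} = PiE UNIV (\<lambda>i. {..\<gamma> i})"
    by (auto simp: le_fun_def PiE_def Pi_def)
  then show ?thesis by (simp add: finite_PiE)
qed

text \<open>Adding one term at a time, with repeated indices allowed, makes the closure properties
  plain inductions without bookkeeping of supports; \<open>multi_He_span_expansion\<close> merges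
  the repetitions.\<close>

inductive multi_He_span :: "(real ^ 'n::finite \<Rightarrow> real) \<Rightarrow> bool" where
  zero: "multi_He_span (\<lambda>_. 0)"
| add: "multi_He_span f \<Longrightarrow> multi_He_span (\<lambda>x. c * multi_He \<gamma> x + f x)"

section \<open>Closure properties of the span of Hermite products\<close>

lemma multi_He_span_add:
  assumes "multi_He_span f" "multi_He_span g"
  shows "multi_He_span (\<lambda>x. f x + g x)"
  using assms(1)
  by induction (simp_all add: assms(2) add.assoc multi_He_span.add)

lemma multi_He_span_sum:
  assumes "\<And>a. a \<in> A \<Longrightarrow> multi_He_span (f a)"
  shows "multi_He_span (\<lambda>x. \<Sum>a\<in>A. f a x)"
  using assms
  by (induction A rule: infinite_finite_induct) (simp_all add: multi_He_span.zero multi_He_span_add)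

lemma multi_He_span_cmult:
  assumes "multi_He_span f"
  shows "multi_He_span (\<lambda>x. k * f x)"
  using assms
proof induction
  case (add f c \<gamma>)
  from multi_He_span.add[OF add.IH, of "k * c" \<gamma>] show ?case
    by (simp add: algebra_simps)
qed (simp add: multi_He_span.zero)

lemma multi_He_span_multi_He: "multi_He_span (\<lambda>x. c * multi_He \<gamma> x)"
  using multi_He_span.add[OF multi_He_span.zero, of c \<gamma>] by simp

lemma multi_He_span_times_coord:
  assumes "multi_He_span f"
  shows "multi_He_span (\<lambda>x. x $ i * f x)"
  using assms
proof induction
  case (add f c \<gamma>)
  have "x $ i * (c * multi_He \<gamma> x + f x) = c * multi_He (\<gamma>(i := Suc (\<gamma> i))) x
     + ((c * real (\<gamma> i)) * multi_He (\<gamma>(i := \<gamma> i - 1)) x + x $ i * f x)" for x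
    using arg_cong[OF multi_He_times_coord[of x i \<gamma>], of "(*) c"] by (simp add: algebra_simps)
  then show ?case
    by (simp only:) (intro multi_He_span.add add.IH)
qed (simp add: multi_He_span.zero)

text \<open>Stated for products with an arbitrary element of the span so that the product case of the
  induction over \<open>p\<close> goes through.\<close>

lemma multi_He_span_times_polynomial:
  fixes p :: "real ^ 'n::finite \<Rightarrow> real"
  assumes "real_polynomial_function p" "multi_He_span f"
  shows "multi_He_span (\<lambda>x. p x * f x)"
  using assms
proof (induction arbitrary: f)
  case (linear p)
  note f = \<open>multi_He_span f\<close>
  interpret bounded_linear p by fact
  \<comment> \<open>A linear form is a combination of coordinates, which reduces this case to
    \<open>multi_He_span_times_coord\<close>.\<close>
  have p: "p x = (\<Sum>i\<in>UNIV. x $ i * p (axis i 1))" for x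
  proof -
    have "p x = p (\<Sum>i\<in>UNIV. x $ i *\<^sub>R axis i 1)"
      using basis_expansion[of x] by (simp add: scalar_mult_eq_scaleR)
    then show ?thesis by (simp add: sum scaleR)
  qed
  have "p x * f x = (\<Sum>i\<in>UNIV. p (axis i 1) * (x $ i * f x))" for x
    by (subst p) (simp add: sum_distrib_left mult_ac)
  then show ?case
    using f by (auto intro!: multi_He_span_sum multi_He_span_cmult multi_He_span_times_coord)
next
  case (add p q)
  then show ?case by (simp add: distrib_right multi_He_span_add)
next
  case (mult p q)
  then show ?case by (simp add: mult.assoc)
qed (rule multi_He_span_cmult)

lemma multi_He_span_polynomial:
  assumes "real_polynomial_function p"
  shows "multi_He_span p"
  using multi_He_span_times_polynomial[OF assms multi_He_span_multi_He[of 1 "\<lambda>_. 0"]] by simp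

lemma multi_He_span_expansion:
  assumes "multi_He_span f"
  obtains A c where "finite A" "f = (\<lambda>x. \<Sum>\<gamma>\<in>A. c \<gamma> * multi_He \<gamma> x)"
  using assms
proof (induction arbitrary: thesis)
  case zero
  show ?case by (rule zero[of "{}"]) auto
next
  case (add f k \<beta>)
  obtain A c where A: "finite A" "f = (\<lambda>x. \<Sum>\<gamma>\<in>A. c \<gamma> * multi_He \<gamma> x)"
    using add.IH by blast
  \<comment> \<open>\<open>\<beta>\<close> may or may not lie in \<open>A\<close>, and
    \<open>c\<close> is arbitrary outside \<open>A\<close>; hence both tests.\<close>
  define d where "d \<gamma> = (if \<gamma> \<in> A then c \<gamma> else 0) + (if \<gamma> = \<beta> then k else 0)" for \<gamma>
  have "k * multi_He \<beta> x + f x = (\<Sum>\<gamma>\<in>insert \<beta> A. d \<gamma> * multi_He \<gamma> x)" for x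
  proof -
    have "(\<Sum>\<gamma>\<in>insert \<beta> A. d \<gamma> * multi_He \<gamma> x) =
        (\<Sum>\<gamma>\<in>insert \<beta> A. if \<gamma> \<in> A then c \<gamma> * multi_He \<gamma> x else 0) +
        (\<Sum>\<gamma>\<in>insert \<beta> A. if \<gamma> = \<beta> then k * multi_He \<gamma> x else 0)"
      unfolding sum.distrib[symmetric] by (intro sum.cong) (auto simp: d_def algebra_simps)
    also have "(\<Sum>\<gamma>\<in>insert \<beta> A. if \<gamma> \<in> A then c \<gamma> * multi_He \<gamma> x else 0) =
        (\<Sum>\<gamma>\<in>A. c \<gamma> * multi_He \<gamma> x)"
      using A(1) by (intro sum.mono_neutral_cong_right) auto
    also have "(\<Sum>\<gamma>\<in>insert \<beta> A. if \<gamma> = \<beta> then k * multi_He \<gamma> x else 0) = k * multi_He \<beta> x"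
      using A(1) by (subst sum.delta) auto
    finally show ?thesis by (simp add: A(2))
  qed
  then show ?case
    using A(1) by (intro add.prems[of "insert \<beta> A" d]) auto
qed

text \<open>The difference of two expansions, taken over the union of their supports, is a vanishing
  combination of Hermite products, so linear independence makes the coefficients agree. This
  justifies the definite description in \<open>hermite_coeff\<close>.\<close>

lemma hermite_coeff_eqI:
  assumes fin: "finite {\<alpha>. c \<alpha> \<noteq> 0}"
    and f: "\<And>x. f x = (\<Sum>\<alpha> | c \<alpha> \<noteq> 0. c \<alpha> * hermite \<alpha> x)"
  shows "hermite_coeff f = c"
  unfolding hermite_coeff_def
proof (rule the_equality)
  fix d assume d: "finite {\<alpha>. d \<alpha> \<noteq> 0} \<and> (\<forall>x. f x = (\<Sum>\<alpha> | d \<alpha> \<noteq> 0. d \<alpha> * hermite \<alpha> x))"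
  define A where "A = {\<alpha>. c \<alpha> \<noteq> 0} \<union> {\<alpha>. d \<alpha> \<noteq> 0}"
  have A: "finite A" using d fin by (simp add: A_def)
  have "(\<Sum>\<alpha>\<in>A. ((d \<alpha> - c \<alpha>) / sqrt (mfact \<alpha>)) * multi_He \<alpha> x) = 0" for x
  proof -
    have "(\<Sum>\<alpha>\<in>A. ((d \<alpha> - c \<alpha>) / sqrt (mfact \<alpha>)) * multi_He \<alpha> x) =
        (\<Sum>\<alpha>\<in>A. d \<alpha> * hermite \<alpha> x) - (\<Sum>\<alpha>\<in>A. c \<alpha> * hermite \<alpha> x)"
      by (simp add: hermite_eq_multi_He sum_subtractf[symmetric] diff_divide_distrib left_diff_distrib)
    also have "(\<Sum>\<alpha>\<in>A. d \<alpha> * hermite \<alpha> x) = f x"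
      using d A by (auto simp: A_def intro!: sum.mono_neutral_right)
    also have "(\<Sum>\<alpha>\<in>A. c \<alpha> * hermite \<alpha> x) = f x"
      unfolding f using A by (auto simp: A_def intro!: sum.mono_neutral_right)
    finally show ?thesis by simp
  qed
  then have "(d \<alpha> - c \<alpha>) / sqrt (mfact \<alpha>) = 0" if "\<alpha> \<in> A" for \<alpha>
    using multi_He_sum_eq_0D[OF A _ that, of "\<lambda>\<alpha>. (d \<alpha> - c \<alpha>) / sqrt (mfact \<alpha>)"] by blast
  then have eq: "d \<alpha> = c \<alpha>" if "\<alpha> \<in> A" for \<alpha>
    using that less_imp_neq[OF mfact_pos, of \<alpha>] by auto
  have "d \<alpha> = c \<alpha>" for \<alpha>
    using eq[of \<alpha>] by (cases "\<alpha> \<in> A") (simp, simp add: A_def)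
  then show "d = c" ..
qed (use assms in auto)

lemma hermite_expansion:
  assumes "real_polynomial_function f"
  shows "finite {\<alpha>. hermite_coeff f \<alpha> \<noteq> 0}"
    and "f x = (\<Sum>\<alpha> | hermite_coeff f \<alpha> \<noteq> 0. hermite_coeff f \<alpha> * hermite \<alpha> x)"
proof -
  obtain A c where A: "finite A" "f = (\<lambda>x. \<Sum>\<gamma>\<in>A. c \<gamma> * multi_He \<gamma> x)"
    using multi_He_span_expansion[OF multi_He_span_polynomial[OF assms]] by blast
  \<comment> \<open>The square root changes from \<open>multi_He\<close> to \<open>hermite\<close>;
    the value 0 outside \<open>A\<close> keeps the support finite.\<close>
  define d where "d \<gamma> = (if \<gamma> \<in> A then c \<gamma> * sqrt (mfact \<gamma>) else 0)" for \<gamma>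
  have d: "finite {\<alpha>. d \<alpha> \<noteq> 0}"
    by (rule finite_subset[OF _ A(1)]) (auto simp: d_def)
  have f: "f x = (\<Sum>\<alpha> | d \<alpha> \<noteq> 0. d \<alpha> * hermite \<alpha> x)" for x
  proof -
    have "f x = (\<Sum>\<alpha>\<in>A. d \<alpha> * hermite \<alpha> x)"
      unfolding A(2) using mfact_pos
      by (intro sum.cong) (auto simp: d_def hermite_eq_multi_He less_le)
    also have "\<dots> = (\<Sum>\<alpha> | d \<alpha> \<noteq> 0. d \<alpha> * hermite \<alpha> x)"
      using A(1) by (intro sum.mono_neutral_right) (auto simp: d_def)
    finally show ?thesis .
  qed
  show "finite {\<alpha>. hermite_coeff f \<alpha> \<noteq> 0}"
    and "f x = (\<Sum>\<alpha> | hermite_coeff f \<alpha> \<noteq> 0. hermite_coeff f \<alpha> * hermite \<alpha> x)"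
    using d f by (simp_all only: hermite_coeff_eqI[OF d f])
qed

section \<open>Rotation formulas\<close>

text \<open>Apply \<open>He_rotation\<close> to He_(m-l) and shift the index by k = j + l; for l > m
  both sides are 0. The powers are arranged for the final formula: \<open>a ^ m\<close> is the
  factor from the noise operator, \<open>1 / a ^ l\<close> the prefactor, and \<open>b / a\<close>
  becomes the square root of lam / (1 - lam).\<close>

lemma He_rotation_falling_fact:
  assumes "a\<^sup>2 + b\<^sup>2 = 1" and "a \<noteq> 0"
  shows "falling_fact m l * He (m - l) (a * s + b * t) =
    (\<Sum>k\<in>{l..m}. falling_fact m k / fact (k - l) * (a ^ m / a ^ l) * (b / a) ^ (k - l) *
       He (m - k) s * He (k - l) t)"
proof (cases "l \<le> m")
  case True
  have "(\<Sum>k\<in>{l..m}. falling_fact m k / fact (k - l) * (a ^ m / a ^ l) * (b / a) ^ (k - l) *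
        He (m - k) s * He (k - l) t) =
      (\<Sum>j\<le>m - l. falling_fact m (j + l) / fact j * (a ^ m / a ^ l) * (b / a) ^ j *
        He (m - (j + l)) s * He j t)"
    using True by (intro sum.reindex_bij_witness[of _ "\<lambda>j. j + l" "\<lambda>k. k - l"]) auto
  also have "\<dots> = (\<Sum>j\<le>m - l. falling_fact m l *
      (real ((m - l) choose j) * a ^ (m - l - j) * b ^ j * He (m - l - j) s * He j t))"
  proof (rule sum.cong[OF refl])
    fix j assume j: "j \<in> {..m - l}"
    have coef: "falling_fact m (j + l) / fact j = falling_fact m l * real ((m - l) choose j)"
      using j True by (simp add: falling_fact_fact binomial_fact add.commute)
    have "a ^ m = a ^ (m - l - j) * a ^ j * a ^ l"
      using j True by (simp flip: power_add)
    then have "(a ^ m / a ^ l) * (b / a) ^ j = a ^ (m - l - j) * b ^ j"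
      using assms(2) by (simp add: power_divide)
    moreover have "m - l - j = m - (j + l)"
      by simp
    ultimately have "(falling_fact m (j + l) / fact j) * ((a ^ m / a ^ l) * (b / a) ^ j) *
        He (m - (j + l)) s * He j t = falling_fact m l * real ((m - l) choose j) *
        (a ^ (m - l - j) * b ^ j) * He (m - l - j) s * He j t"
      by (simp only: coef)
    then show "falling_fact m (j + l) / fact j * (a ^ m / a ^ l) * (b / a) ^ j *
        He (m - (j + l)) s * He j t = falling_fact m l *
        (real ((m - l) choose j) * a ^ (m - l - j) * b ^ j * He (m - l - j) s * He j t)"
      by (simp only: mult.assoc)
  qed
  finally show ?thesis
    by (simp add: He_rotation[OF assms(1)] sum_distrib_left)
qed (simp add: falling_fact_eq_0_iff)

lemma multi_He_rotation:
  fixes \<alpha> \<gamma> :: "'n::finite \<Rightarrow> nat" and x y :: "real ^ 'n"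
  assumes "a\<^sup>2 + b\<^sup>2 = 1" and "a \<noteq> 0"
  shows "(\<Prod>i\<in>UNIV. falling_fact (\<gamma> i) (\<alpha> i)) * multi_He (\<gamma> - \<alpha>) (a *\<^sub>R x + b *\<^sub>R y) =
    (\<Sum>\<beta> | \<alpha> \<le> \<beta> \<and> \<beta> \<le> \<gamma>.
       (\<Prod>i\<in>UNIV. falling_fact (\<gamma> i) (\<beta> i)) / mfact (\<beta> - \<alpha>) * (a ^ mabs \<gamma> / a ^ mabs \<alpha>) *
       (b / a) ^ mabs (\<beta> - \<alpha>) * multi_He (\<gamma> - \<beta>) x * multi_He (\<beta> - \<alpha>) y)"
proof -
  \<comment> \<open>The order interval is a product of intervals, so the product over coordinates of
    one-variable sums expands into a single sum over it.\<close>
  have box: "{\<beta>. \<alpha> \<le> \<beta> \<and> \<beta> \<le> \<gamma>} = PiE UNIV (\<lambda>i. {\<alpha> i..\<gamma> i})"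
    by (auto simp: le_fun_def PiE_def Pi_def)
  have "(\<Prod>i\<in>UNIV. falling_fact (\<gamma> i) (\<alpha> i)) * multi_He (\<gamma> - \<alpha>) (a *\<^sub>R x + b *\<^sub>R y) =
    (\<Prod>i\<in>UNIV. \<Sum>k\<in>{\<alpha> i..\<gamma> i}. falling_fact (\<gamma> i) k / fact (k - \<alpha> i) * (a ^ \<gamma> i / a ^ \<alpha> i) *
       (b / a) ^ (k - \<alpha> i) * He (\<gamma> i - k) (x $ i) * He (k - \<alpha> i) (y $ i))"
    by (simp add: multi_He_def He_rotation_falling_fact[OF assms] flip: prod.distrib)
  also have "\<dots> = (\<Sum>\<beta> | \<alpha> \<le> \<beta> \<and> \<beta> \<le> \<gamma>. \<Prod>i\<in>UNIV. falling_fact (\<gamma> i) (\<beta> i) / fact (\<beta> i - \<alpha> i) *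
       (a ^ \<gamma> i / a ^ \<alpha> i) * (b / a) ^ (\<beta> i - \<alpha> i) * He (\<gamma> i - \<beta> i) (x $ i) * He (\<beta> i - \<alpha> i) (y $ i))"
    unfolding box by (subst prod_sum_PiE) auto
  finally show ?thesis
    by (simp add: multi_He_def mfact_def mabs_def prod.distrib prod_dividef power_sum)
qed

section \<open>The identity for arbitrary polynomials\<close>

lemma powr_half_nat: "u > 0 \<Longrightarrow> u powr (real k / 2) = sqrt u ^ k"
  by (simp add: powr_half_sqrt_powr powr_realpow real_sqrt_power)

text \<open>The index set of the sum is infinite, and \<open>infsum\<close> returns 0 for a family
  that is not summable. The finiteness conjunct shows that the sum is really a finite one.\<close>

theorem theorem3p6:
  fixes f g :: "real ^ 'n \<Rightarrow> real" and lam :: real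
    and \<alpha> :: "'n \<Rightarrow> nat" and x y :: "real ^ 'n"
  assumes "real_polynomial_function f"
    and "0 < lam" and "lam < 1"
    and "g = noise_op (sqrt (1 - lam)) f"
  shows "finite {\<beta>. \<alpha> \<le> \<beta> \<and> mixed_deriv \<beta> g x \<noteq> 0} \<and>
    mixed_deriv \<alpha> f (sqrt (1 - lam) *\<^sub>R x + sqrt lam *\<^sub>R y) =
      (1 - lam) powr (- real (mabs \<alpha>) / 2) *
      (\<Sum>\<^sub>\<infinity>\<beta>\<in>{\<beta>. \<alpha> \<le> \<beta>}.
         mixed_deriv \<beta> g x / sqrt (mfact (\<beta> - \<alpha>)) *
         (lam / (1 - lam)) powr (real (mabs (\<beta> - \<alpha>)) / 2) *
         hermite (\<beta> - \<alpha>) y)"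
proof -
  define a b where "a = sqrt (1 - lam)" and "b = sqrt lam"
  have ab: "a\<^sup>2 + b\<^sup>2 = 1" "a \<noteq> 0"
    using assms(2,3) by (simp_all add: a_def b_def)
  define A where "A = {\<gamma>. hermite_coeff f \<gamma> \<noteq> 0}"
  define c where "c \<gamma> = hermite_coeff f \<gamma> / sqrt (mfact \<gamma>)" for \<gamma>
  define ff where "ff \<gamma> \<beta> = (\<Prod>i\<in>UNIV. falling_fact (\<gamma> i) (\<beta> i))" for \<gamma> \<beta> :: "'n \<Rightarrow> nat"
  have A: "finite A"
    using hermite_expansion(1)[OF assms(1)] by (simp add: A_def)
  have f: "f = (\<lambda>x. \<Sum>\<gamma>\<in>A. c \<gamma> * multi_He \<gamma> x)"
    using hermite_expansion(2)[OF assms(1)] by (simp add: fun_eq_iff A_def c_def hermite_eq_multi_He)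
  \<comment> \<open>Both \<open>f\<close> and \<open>g\<close> are expanded over the same
    \<open>A\<close>, so the claim can be compared term by term in \<open>\<gamma>\<close>.\<close>
  have g: "g = (\<lambda>x. \<Sum>\<gamma>\<in>A. (c \<gamma> * a ^ mabs \<gamma>) * multi_He \<gamma> x)"
    unfolding assms(4) noise_op_def fun_eq_iff A_def c_def hermite_eq_multi_He a_def by (simp add: mult.assoc)
  have Df: "mixed_deriv \<beta> f z = (\<Sum>\<gamma>\<in>A. c \<gamma> * (ff \<gamma> \<beta> * multi_He (\<gamma> - \<beta>) z))" for \<beta> z
    unfolding f mixed_deriv_sum_multi_He[OF A, where d = "\<lambda>\<gamma>. \<gamma>"] ff_def by (simp add: mult.assoc)
  have Dg: "mixed_deriv \<beta> g z = (\<Sum>\<gamma>\<in>A. c \<gamma> * (a ^ mabs \<gamma> * (ff \<gamma> \<beta> * multi_He (\<gamma> - \<beta>) z)))" for \<beta> z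
    unfolding g mixed_deriv_sum_multi_He[OF A, where d = "\<lambda>\<gamma>. \<gamma>"] ff_def by (simp add: mult.assoc)
  have ff_0: "ff \<gamma> \<beta> = 0 \<longleftrightarrow> \<not> \<beta> \<le> \<gamma>" for \<gamma> \<beta>
    unfolding ff_def by (rule prod_falling_fact_eq_0_iff)
  define B where "B = (\<Union>\<gamma>\<in>A. {\<beta>. \<alpha> \<le> \<beta> \<and> \<beta> \<le> \<gamma>})"
  have B: "finite B"
    unfolding B_def by (intro finite_UN_I A finite_subset[OF _ finite_atMost_multi_index]) auto
  have Dg_0: "mixed_deriv \<beta> g x = 0" if "\<alpha> \<le> \<beta>" "\<beta> \<notin> B" for \<beta>
    unfolding Dg using that by (intro sum.neutral) (auto simp: B_def ff_0)
  have sqrt_quot: "sqrt (lam / (1 - lam)) = b / a"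
    by (simp add: a_def b_def real_sqrt_divide)
  \<comment> \<open>\<open>T\<close> collects the factors independent of \<open>g\<close>. The
    square root in the formula and the one normalising \<open>hermite\<close> multiply to (beta -
    alpha)!.\<close>
  define T where "T \<beta> = (b / a) ^ mabs (\<beta> - \<alpha>) / mfact (\<beta> - \<alpha>) * multi_He (\<beta> - \<alpha>) y" for \<beta>
  have T: "mixed_deriv \<beta> g x / sqrt (mfact (\<beta> - \<alpha>)) *
      (lam / (1 - lam)) powr (real (mabs (\<beta> - \<alpha>)) / 2) * hermite (\<beta> - \<alpha>) y =
      mixed_deriv \<beta> g x * T \<beta>" for \<beta>
  proof -
    have "sqrt (mfact (\<beta> - \<alpha>)) * sqrt (mfact (\<beta> - \<alpha>)) = mfact (\<beta> - \<alpha>)"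
      using mfact_pos[of "\<beta> - \<alpha>"] by simp
    then show ?thesis
      using assms(2,3) by (simp add: T_def hermite_eq_multi_He powr_half_nat sqrt_quot)
  qed
  have "(\<Sum>\<^sub>\<infinity>\<beta>\<in>{\<beta>. \<alpha> \<le> \<beta>}. mixed_deriv \<beta> g x * T \<beta>) = (\<Sum>\<^sub>\<infinity>\<beta>\<in>B. mixed_deriv \<beta> g x * T \<beta>)"
    by (rule infsum_cong_neutral) (auto simp: Dg_0, auto simp: B_def)
  also have "\<dots> = (\<Sum>\<beta>\<in>B. mixed_deriv \<beta> g x * T \<beta>)"
    using B by simp
  also have "\<dots> = (\<Sum>\<gamma>\<in>A. c \<gamma> * (\<Sum>\<beta>\<in>B. a ^ mabs \<gamma> * (ff \<gamma> \<beta> * multi_He (\<gamma> - \<beta>) x) * T \<beta>))"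
    unfolding Dg sum_distrib_right sum_distrib_left by (subst sum.swap) (simp add: mult.assoc)
  also have "\<dots> = (\<Sum>\<gamma>\<in>A. c \<gamma> * (a ^ mabs \<alpha> * (ff \<gamma> \<alpha> * multi_He (\<gamma> - \<alpha>) (a *\<^sub>R x + b *\<^sub>R y))))"
  proof (intro sum.cong refl arg_cong2[of _ _ _ _ "(*)"])
    fix \<gamma> assume "\<gamma> \<in> A"
    \<comment> \<open>\<open>B\<close> is the union of the intervals for all \<open>\<gamma>\<close>
      in \<open>A\<close>; for a single \<open>\<gamma>\<close> the indices outside its own interval
      contribute 0, leaving the sum in \<open>multi_He_rotation\<close>.\<close>
    have "(\<Sum>\<beta>\<in>B. a ^ mabs \<gamma> * (ff \<gamma> \<beta> * multi_He (\<gamma> - \<beta>) x) * T \<beta>) =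
        (\<Sum>\<beta> | \<alpha> \<le> \<beta> \<and> \<beta> \<le> \<gamma>. a ^ mabs \<gamma> * (ff \<gamma> \<beta> * multi_He (\<gamma> - \<beta>) x) * T \<beta>)"
      using B \<open>\<gamma> \<in> A\<close> by (intro sum.mono_neutral_right) (auto simp: B_def ff_0)
    also have "\<dots> = a ^ mabs \<alpha> * (ff \<gamma> \<alpha> * multi_He (\<gamma> - \<alpha>) (a *\<^sub>R x + b *\<^sub>R y))"
      \<comment> \<open>The factor \<open>a ^ mabs \<alpha>\<close> cancels the denominator in the
        rotation formula, leaving the \<open>a ^ mabs \<gamma>\<close> that comes from
        \<open>g\<close>.\<close>
      unfolding ff_def multi_He_rotation[OF ab] sum_distrib_left
      using ab(2) by (intro sum.cong) (simp_all add: T_def)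
    finally show "(\<Sum>\<beta>\<in>B. a ^ mabs \<gamma> * (ff \<gamma> \<beta> * multi_He (\<gamma> - \<beta>) x) * T \<beta>) =
        a ^ mabs \<alpha> * (ff \<gamma> \<alpha> * multi_He (\<gamma> - \<alpha>) (a *\<^sub>R x + b *\<^sub>R y))" .
  qed
  also have "\<dots> = a ^ mabs \<alpha> * mixed_deriv \<alpha> f (a *\<^sub>R x + b *\<^sub>R y)"
    by (simp add: Df sum_distrib_left mult.left_commute)
  finally have sum_eq: "(\<Sum>\<^sub>\<infinity>\<beta>\<in>{\<beta>. \<alpha> \<le> \<beta>}. mixed_deriv \<beta> g x * T \<beta>) =
      a ^ mabs \<alpha> * mixed_deriv \<alpha> f (a *\<^sub>R x + b *\<^sub>R y)" .
  have "(1 - lam) powr (- real (mabs \<alpha>) / 2) = inverse (a ^ mabs \<alpha>)"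
    using assms(3) by (simp add: powr_minus powr_half_nat a_def)
  moreover have "finite {\<beta>. \<alpha> \<le> \<beta> \<and> mixed_deriv \<beta> g x \<noteq> 0}"
    by (rule finite_subset[OF _ B]) (use Dg_0 in auto)
  ultimately show ?thesis
    unfolding T sum_eq using ab(2) by (simp flip: a_def b_def)
qed

end
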